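(* Let $G$ be a finite group and $N\trianglelefteq G$. The defect maps commute with the inflation and fixed-point maps, that is, $$\operatorname{Def}_G\circ\operatorname{Inf}=\operatorname{Inf}\circ\operatorname{Def}_{G/N}:V_{G/N}\longrightarrow\mathfrak D_G$$ and $$\operatorname{Def}_{G/N}\circ\operatorname{Fix}=\operatorname{Fix}\circ\operatorname{Def}_G:V_G\longrightarrow\mathfrak D_{G/N}.$$
   Context: For a finite group $G$, $\operatorname{Sub}(G)^c$ is the set of conjugacy classes $(H)$ of subgroups of $G$; $\operatorname{core}_G(H)=\bigcap_{g\in G}gHg^{-1}$; $\operatorname{Sub}_{\mathrm{ncc}}(G)$ is the set of subgroups $H\le G$ with $H/\operatorname{core}_G(H)$ noncyclic (non-core-cyclic subgroups), $\operatorname{Sub}_{\mathrm{ncc}}(G)^c$ the set of their conjugacy classes, and $V_G:=\mathbb F_2^{\operatorname{Sub}_{\mathrm{ncc}}(G)^c}$. For a finite group $W$, $\operatorname{Cl}_0(W,\mathbb F_2)$ is the $\mathbb F_2$-space of class functions $f:W\to\mathbb F_2$ with $f(1)=0$, and $\mathfrak D(W):=\operatorname{Cl}_0(W,\mathbb F_2)/\operatorname{Hom}(W,\mathbb F_2)$. Put $W_G(K)=N_G(K)/K$. For $x\in V_G$ let $\widetilde x\in\mathbb F_2^{\operatorname{Sub}(G)^c}$ be its extension by $0$. For $K\le G$, $g\in N_G(K)$ put $\lambda_{x,K}(gK)=\widetilde x_{(\langle K,g\rangle)}+\widetilde x_{(K)}$, an element of $\operatorname{Cl}_0(W_G(K),\mathbb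 F_2)$. Choosing one representative $K$ of each class, $\mathfrak D_G:=\bigoplus_{(K)\in\operatorname{Sub}(G)^c}\mathfrak D(W_G(K))$, and $\operatorname{Def}_G:V_G\to\mathfrak D_G$ is the linear map $x\mapsto([\lambda_{x,K}])_{(K)}$. Let $\pi:G\to G/N$ be the quotient map, $\pi(H)=HN/N$, and $\widehat L=\pi^{-1}(L)$ for $L\le G/N$. (If $H$ is core-cyclic so is $\pi(H)$; $L$ is core-cyclic in $G/N$ iff $\widehat L$ is core-cyclic in $G$.) Define linear maps: $\operatorname{Inf}:V_{G/N}\to V_G$ by $\operatorname{Inf}(x)_{(H)}=x_{(\pi(H))}$ if $\pi(H)\in\operatorname{Sub}_{\mathrm{ncc}}(G/N)$ and $0$ otherwise; $\operatorname{Fix}:V_G\to V_{G/N}$ by $\operatorname{Fix}(y)_{(L)}=y_{(\widehat L)}$. For $H\le G$ let $\overline\pi_H:W_G(H)\to W_{G/N}(\pi(H))$, $gH\mapsto\pi(g)\pi(H)$, with induced pullback $\overline\pi_H^*:\mathfrak D(W_{G/N}(\pi(H)))\to\mathfrak D(W_G(H))$; for $H=\widehat L$, $\overline\pi_{\widehat L}$ is an isomorphism onto $W_{G/N}(L)$. Choose class representatives so that for each chosen representative $L$ in $G/N$, $\widehat L$ is a chosen representative in $G$, and identify local defect spaces of conjugate subgroups via conjugation. Define linear maps with the same names: $\operatorname{Inf}:\mathfrak D_{G/N}\to\mathfrak D_G$, $\operatorname{Inf}(\omega)_H=\overline\pi_H^*(\omega_{\pi(H)})$; $\operatorname{Fix}:\mathfrak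 D_G\to\mathfrak D_{G/N}$, $\operatorname{Fix}(\eta)_L=(\overline\pi_{\widehat L}^* )^{-1}(\eta_{\widehat L})$. *)

theory Defs
  imports "HOL-Algebra.Elementary_Groups" "HOL-Algebra.Product_Groups" "HOL-Algebra.Zassenhaus" "HOL-Library.Z2"
begin

text \<open>
  A vector space over the two-element field is the same thing as an abelian group of exponent
  two, and a linear map is the same thing as an additive map. Below, these spaces are given by
  their additive groups (written multiplicatively, as everything in \<^theory>\<open>HOL-Algebra.Group\<close>),
  so that linear maps are elements of \<^const>\<open>hom\<close> and quotients are formed with
  \<^const>\<open>FactGroup\<close>. Vectors are extensional functions on their index set.

  Where a value is prescribed through a representative of a coset or of a conjugacy class,
  \<^const>\<open>the_elem\<close> picks the common value over all representatives.
\<close>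

definition F2 :: "bit monoid" where
  "F2 = \<lparr>carrier = UNIV, monoid.mult = (+), one = 0\<rparr>"

definition conj_by :: "('a, 'b) monoid_scheme \<Rightarrow> 'a \<Rightarrow> 'a set \<Rightarrow> 'a set" where
  "conj_by G g S = g <#\<^bsub>G\<^esub> S #>\<^bsub>G\<^esub> inv\<^bsub>G\<^esub> g"

definition conj_class :: "('a, 'b) monoid_scheme \<Rightarrow> 'a set \<Rightarrow> 'a set set" where
  "conj_class G H = (\<lambda>g. conj_by G g H) ` carrier G"

definition Sub_classes :: "('a, 'b) monoid_scheme \<Rightarrow> 'a set set set" where
  "Sub_classes G = conj_class G ` {H. subgroup H G}"

definition core :: "('a, 'b) monoid_scheme \<Rightarrow> 'a set \<Rightarrow> 'a set" where
  "core G H = (\<Inter>g\<in>carrier G. conj_by G g H)"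

definition core_cyclic :: "('a, 'b) monoid_scheme \<Rightarrow> 'a set \<Rightarrow> bool" where
  "core_cyclic G H \<longleftrightarrow> cyclic_group (G\<lparr>carrier := H\<rparr> Mod core G H)"

definition Sub_ncc :: "('a, 'b) monoid_scheme \<Rightarrow> 'a set set" where
  "Sub_ncc G = {H. subgroup H G \<and> \<not> core_cyclic G H}"

definition Sub_ncc_classes :: "('a, 'b) monoid_scheme \<Rightarrow> 'a set set set" where
  "Sub_ncc_classes G = conj_class G ` Sub_ncc G"

definition V :: "('a, 'b) monoid_scheme \<Rightarrow> ('a set set \<Rightarrow> bit) monoid" where
  "V G = product_group (Sub_ncc_classes G) (\<lambda>_. F2)"

definition ext0 :: "('a, 'b) monoid_scheme \<Rightarrow> ('a set set \<Rightarrow> bit) \<Rightarrow> 'a set set \<Rightarrow> bit" where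
  "ext0 G x c = (if c \<in> Sub_ncc_classes G then x c else 0)"

definition Cl0 :: "('a, 'b) monoid_scheme \<Rightarrow> ('a \<Rightarrow> bit) monoid" where
  "Cl0 W = product_group (carrier W) (\<lambda>_. F2)
     \<lparr>carrier := {f \<in> carrier W \<rightarrow>\<^sub>E UNIV. f \<one>\<^bsub>W\<^esub> = 0 \<and>
        (\<forall>u\<in>carrier W. \<forall>v\<in>carrier W. f (u \<otimes>\<^bsub>W\<^esub> v \<otimes>\<^bsub>W\<^esub> inv\<^bsub>W\<^esub> u) = f v)}\<rparr>"

definition HomF2 :: "('a, 'b) monoid_scheme \<Rightarrow> ('a \<Rightarrow> bit) set" where
  "HomF2 W = hom W F2 \<inter> extensional (carrier W)"

definition defect :: "('a, 'b) monoid_scheme \<Rightarrow> ('a \<Rightarrow> bit) set monoid" where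
  "defect W = Cl0 W Mod HomF2 W"

definition dclass :: "('a, 'b) monoid_scheme \<Rightarrow> ('a \<Rightarrow> bit) \<Rightarrow> ('a \<Rightarrow> bit) set" where
  "dclass W f = HomF2 W #>\<^bsub>Cl0 W\<^esub> f"

text \<open>
  Precomposition with a homomorphism \<open>\<psi>\<close> with domain \<open>A\<close>, on classes modulo \<^const>\<open>HomF2\<close>;
  the result is the same for all \<open>f\<close> in the coset \<open>X\<close>.
\<close>

definition pullback ::
    "('a, 'b) monoid_scheme \<Rightarrow> ('a \<Rightarrow> 'c) \<Rightarrow> ('c \<Rightarrow> bit) set \<Rightarrow> ('a \<Rightarrow> bit) set" where
  "pullback A \<psi> X = the_elem ((\<lambda>f. dclass A (compose (carrier A) f \<psi>)) ` X)"

text \<open>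
  \<^const>\<open>FactGroup\<close> consists of right cosets, but \<open>Kg = gK\<close> for \<open>g\<close> in the normalizer of \<open>K\<close>.
\<close>

definition Weyl :: "('a, 'b) monoid_scheme \<Rightarrow> 'a set \<Rightarrow> 'a set monoid" where
  "Weyl G K = G\<lparr>carrier := normalizer G K\<rparr> Mod K"

definition lam ::
    "('a, 'b) monoid_scheme \<Rightarrow> ('a set set \<Rightarrow> bit) \<Rightarrow> 'a set \<Rightarrow> 'a set \<Rightarrow> bit" where
  "lam G x K = (\<lambda>C\<in>carrier (Weyl G K).
     the_elem ((\<lambda>g. ext0 G x (conj_class G (generate G (insert g K)))
                      + ext0 G x (conj_class G K)) ` C))"

definition class_reps :: "('a, 'b) monoid_scheme \<Rightarrow> 'a set set \<Rightarrow> bool" where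
  "class_reps G R \<longleftrightarrow> R \<subseteq> {H. subgroup H G} \<and> (\<forall>c\<in>Sub_classes G. \<exists>!K. K \<in> R \<and> K \<in> c)"

text \<open>
  The direct sum over conjugacy classes is indexed by the chosen representatives \<open>R\<close>.
\<close>

definition DD :: "('a, 'b) monoid_scheme \<Rightarrow> 'a set set \<Rightarrow> ('a set \<Rightarrow> ('a set \<Rightarrow> bit) set) monoid" where
  "DD G R = sum_group R (\<lambda>K. defect (Weyl G K))"

definition Def ::
    "('a, 'b) monoid_scheme \<Rightarrow> 'a set set \<Rightarrow> ('a set set \<Rightarrow> bit) \<Rightarrow> 'a set \<Rightarrow> ('a set \<Rightarrow> bit) set" where
  "Def G R x = (\<lambda>K\<in>R. dclass (Weyl G K) (lam G x K))"

text \<open>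
  The component of \<open>\<omega>\<close> at an arbitrary subgroup \<open>M\<close>: if \<open>L = q M q\<inverse>\<close> is the representative of the
  class of \<open>M\<close>, the component at \<open>L\<close> is transported along the isomorphism from the Weyl group of
  \<open>M\<close> to that of \<open>L\<close> given by conjugation by \<open>q\<close>. The result does not depend on \<open>q\<close>.
\<close>

definition component ::
    "('a, 'b) monoid_scheme \<Rightarrow> 'a set set \<Rightarrow> ('a set \<Rightarrow> ('a set \<Rightarrow> bit) set) \<Rightarrow> 'a set
       \<Rightarrow> ('a set \<Rightarrow> bit) set" where
  "component G R \<omega> M =
     the_elem {pullback (Weyl G M) (conj_by G q) (\<omega> (conj_by G q M)) | q.
                 q \<in> carrier G \<and> conj_by G q M \<in> R}"

definition proj :: "('a, 'b) monoid_scheme \<Rightarrow> 'a set \<Rightarrow> 'a \<Rightarrow> 'a set" where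
  "proj G N g = N #>\<^bsub>G\<^esub> g"

definition lift :: "('a, 'b) monoid_scheme \<Rightarrow> 'a set \<Rightarrow> 'a set set \<Rightarrow> 'a set" where
  "lift G N L = {g \<in> carrier G. proj G N g \<in> L}"

definition Inf_V ::
    "('a, 'b) monoid_scheme \<Rightarrow> 'a set \<Rightarrow> ('a set set set \<Rightarrow> bit) \<Rightarrow> 'a set set \<Rightarrow> bit" where
  "Inf_V G N x = (\<lambda>c\<in>Sub_ncc_classes G.
     the_elem ((\<lambda>H. if proj G N ` H \<in> Sub_ncc (G Mod N)
                    then x (conj_class (G Mod N) (proj G N ` H)) else 0) ` c))"

definition Fix_V ::
    "('a, 'b) monoid_scheme \<Rightarrow> 'a set \<Rightarrow> ('a set set \<Rightarrow> bit) \<Rightarrow> 'a set set set \<Rightarrow> bit" where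
  "Fix_V G N y = (\<lambda>c\<in>Sub_ncc_classes (G Mod N).
     the_elem ((\<lambda>L. y (conj_class G (lift G N L))) ` c))"

text \<open>
  The homomorphism from the Weyl group of \<open>H\<close> to that of \<open>\<pi>(H)\<close> sends the coset \<open>gH\<close> to
  \<open>\<pi>(g) \<pi>(H)\<close>, which is the image of the set \<open>gH\<close> under \<open>\<pi>\<close>.
\<close>

definition Inf_D ::
    "('a, 'b) monoid_scheme \<Rightarrow> 'a set \<Rightarrow> 'a set set \<Rightarrow> 'a set set set
       \<Rightarrow> ('a set set \<Rightarrow> ('a set set \<Rightarrow> bit) set) \<Rightarrow> 'a set \<Rightarrow> ('a set \<Rightarrow> bit) set" where
  "Inf_D G N R R' \<omega> = (\<lambda>H\<in>R.
     pullback (Weyl G H) (image (proj G N)) (component (G Mod N) R' \<omega> (proj G N ` H)))"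

text \<open>
  As \<open>\<pi>(lift L) = L\<close>, the image map under \<open>\<pi>\<close> is here an isomorphism from the Weyl group of
  \<open>lift L\<close> to that of \<open>L\<close>, so the pullback that is inverted is bijective.
\<close>

definition Fix_D ::
    "('a, 'b) monoid_scheme \<Rightarrow> 'a set \<Rightarrow> 'a set set set
       \<Rightarrow> ('a set \<Rightarrow> ('a set \<Rightarrow> bit) set) \<Rightarrow> 'a set set \<Rightarrow> ('a set set \<Rightarrow> bit) set" where
  "Fix_D G N R' \<eta> = (\<lambda>L\<in>R'.
     inv_into (carrier (defect (Weyl (G Mod N) L)))
       (pullback (Weyl G (lift G N L)) (image (proj G N))) (\<eta> (lift G N L)))"

end

theory Submission
  imports Defs
begin

text \<open>
  For a homomorphism \<open>h\<close> out of \<open>G\<close>, the class function \<open>\<lambda>\<close> at \<open>S\<close> is the pullback along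
  \<open>C \<mapsto> h(C)\<close> of the one at \<open>h(S)\<close> as soon as the two vectors agree on each \<open>T \<supseteq> S\<close> and its
  image \<open>h(T)\<close>. Conjugations give that \<open>\<lambda>\<close> is a class function and that components do not depend
  on representatives. The projection \<open>\<pi>\<close> gives both commutation relations: inflation agrees with
  the original vector along \<open>T \<mapsto> \<pi>(T)\<close> for all \<open>T\<close>, because images of core-cyclic subgroups are
  core-cyclic, and fixed points do so for \<open>T \<supseteq> N\<close>, because for those core-cyclicity is also
  reflected. For fixed points one cancels the pullback, which is injective on defect spaces since
  the map of Weyl groups is onto.
\<close>

section \<open>The two-element field as an abelian group\<close>

declare add_bit_eq_xor [simp del]

lemma bit_add_self [simp]: "x + x = (0::bit)"
  by (cases x) simp_all

lemma bit_add_cancel [simp]: "x + (x + y) = (y::bit)"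
  by (simp flip: add.assoc)

lemma F2_simps [simp]: "carrier F2 = UNIV" "monoid.mult F2 = (+)" "one F2 = 0"
  by (simp_all add: F2_def)

lemma comm_group_F2: "comm_group F2"
proof (rule comm_groupI)
  show "\<exists>y\<in>carrier F2. y \<otimes>\<^bsub>F2\<^esub> x = \<one>\<^bsub>F2\<^esub>" for x
    by (rule bexI[of _ x]) simp_all
qed (simp_all add: add_ac)

lemma group_F2 [simp]: "group F2"
  using comm_group_F2 by (rule comm_group.axioms)

lemma inv_F2 [simp]: "inv\<^bsub>F2\<^esub> x = x"
  by (rule group.inv_equality) simp_all

section \<open>Conjugation and cores\<close>

context group
begin

lemma inv_mult_cancel:
  assumes "x \<in> carrier G" "y \<in> carrier G"
  shows "inv x \<otimes> (x \<otimes> y) = y" "x \<otimes> (inv x \<otimes> y) = y"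
  using assms by (simp_all flip: m_assoc)

lemma conj_by_eq_image: "conj_by G g = image (\<lambda>s. g \<otimes> s \<otimes> inv g)"
  by (auto simp: conj_by_def l_coset_def r_coset_def fun_eq_iff)

text \<open>Viewing conjugation as an endomorphism lets each result about images under a
  homomorphism be reused for conjugate subgroups.\<close>

lemma conj_hom: "g \<in> carrier G \<Longrightarrow> group_hom G G (\<lambda>s. g \<otimes> s \<otimes> inv g)"
  by unfold_locales (auto simp: hom_def m_assoc inv_mult_cancel)

lemma conj_surj:
  assumes "g \<in> carrier G"
  shows "(\<lambda>s. g \<otimes> s \<otimes> inv g) ` carrier G = carrier G"
proof
  show "carrier G \<subseteq> (\<lambda>s. g \<otimes> s \<otimes> inv g) ` carrier G"
  proof
    fix x assume "x \<in> carrier G"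
    then show "x \<in> (\<lambda>s. g \<otimes> s \<otimes> inv g) ` carrier G"
      using assms by (intro image_eqI[of _ _ "inv g \<otimes> x \<otimes> g"]) (simp_all add: m_assoc inv_mult_cancel)
  qed
qed (use assms in auto)

lemma conj_by_conj_by:
  assumes "g \<in> carrier G" "k \<in> carrier G" "S \<subseteq> carrier G"
  shows "conj_by G g (conj_by G k S) = conj_by G (g \<otimes> k) S"
  unfolding conj_by_eq_image image_image using assms
  by (intro image_cong) (auto simp: m_assoc inv_mult_group subset_iff)

lemma conj_by_one: "S \<subseteq> carrier G \<Longrightarrow> conj_by G \<one> S = S"
  unfolding conj_by_eq_image by (simp add: subset_iff)

lemma conj_by_inv_conj_by:
  assumes "g \<in> carrier G" "S \<subseteq> carrier G"
  shows "conj_by G (inv g) (conj_by G g S) = S"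
  using assms by (simp add: conj_by_conj_by conj_by_one)

lemma subgroup_conj_by:
  assumes "g \<in> carrier G" "subgroup S G"
  shows "subgroup (conj_by G g S) G"
  unfolding conj_by_eq_image
  by (rule group_hom.subgroup_img_is_subgroup[OF conj_hom[OF assms(1)] assms(2)])

lemma mem_conj_class: "S \<subseteq> carrier G \<Longrightarrow> S \<in> conj_class G S"
  unfolding conj_class_def by (rule image_eqI[of _ _ \<one>]) (simp_all add: conj_by_one)

lemma conj_class_conj_by:
  assumes "g \<in> carrier G" "S \<subseteq> carrier G"
  shows "conj_class G (conj_by G g S) = conj_class G S"
proof
  show "conj_class G (conj_by G g S) \<subseteq> conj_class G S"
    using assms by (auto simp: conj_class_def conj_by_conj_by)
  show "conj_class G S \<subseteq> conj_class G (conj_by G g S)"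
  proof
    fix T assume "T \<in> conj_class G S"
    then obtain k where k: "k \<in> carrier G" "T = conj_by G k S"
      by (auto simp: conj_class_def)
    then have "T = conj_by G (k \<otimes> inv g) (conj_by G g S)"
      using assms by (simp add: conj_by_conj_by m_assoc)
    then show "T \<in> conj_class G (conj_by G g S)"
      using k assms by (auto simp: conj_class_def)
  qed
qed

text \<open>As g runs through the group so does its inverse, so x in every g S g^-1 amounts to g x
  g^-1 in S for every g. This elementwise form is the one that a homomorphism transports.\<close>

lemma mem_core_iff:
  assumes "S \<subseteq> carrier G"
  shows "x \<in> core G S \<longleftrightarrow> x \<in> carrier G \<and> (\<forall>g\<in>carrier G. g \<otimes> x \<otimes> inv g \<in> S)"
proof
  assume x: "x \<in> core G S"
  have "x \<in> conj_by G \<one> S" using x by (auto simp: core_def)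
  then have xc: "x \<in> carrier G" using assms by (auto simp: conj_by_one)
  moreover have "g \<otimes> x \<otimes> inv g \<in> S" if g: "g \<in> carrier G" for g
  proof -
    have "x \<in> conj_by G (inv g) S" using x g by (auto simp: core_def)
    then obtain s where s: "s \<in> S" "x = inv g \<otimes> s \<otimes> g"
      using g by (auto simp: conj_by_eq_image)
    then have "g \<otimes> x \<otimes> inv g = s"
      using g assms by (auto simp: m_assoc inv_mult_cancel subset_iff)
    then show ?thesis using s by simp
  qed
  ultimately show "x \<in> carrier G \<and> (\<forall>g\<in>carrier G. g \<otimes> x \<otimes> inv g \<in> S)" by blast
next
  assume x: "x \<in> carrier G \<and> (\<forall>g\<in>carrier G. g \<otimes> x \<otimes> inv g \<in> S)"
  have "x \<in> conj_by G g S" if g: "g \<in> carrier G" for g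
  proof -
    have "inv g \<otimes> x \<otimes> inv (inv g) \<in> S" using x inv_closed[OF g] by blast
    then have "inv g \<otimes> x \<otimes> g \<in> S" using g by simp
    moreover have "x = g \<otimes> (inv g \<otimes> x \<otimes> g) \<otimes> inv g"
      using x g by (simp add: m_assoc inv_mult_cancel)
    ultimately show ?thesis unfolding conj_by_eq_image by blast
  qed
  then show "x \<in> core G S" by (auto simp: core_def)
qed

lemma core_subset: "S \<subseteq> carrier G \<Longrightarrow> core G S \<subseteq> S"
  unfolding core_def by (rule INF_lower2[of \<one>]) (simp_all add: conj_by_one)

lemma normal_core:
  assumes S: "subgroup S G"
  shows "core G S \<lhd> G"
proof -
  note sub = subgroup.subset[OF S]
  note iff = mem_core_iff[OF sub]
  have "subgroup (core G S) G"
  proof (rule subgroupI)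
    show "core G S \<noteq> {}"
    proof -
      have "\<one> \<in> core G S" using S by (simp add: iff subgroup.one_closed)
      then show ?thesis by blast
    qed
    show "inv a \<in> core G S" if a: "a \<in> core G S" for a
    proof -
      have "g \<otimes> inv a \<otimes> inv g = inv (g \<otimes> a \<otimes> inv g)" if "g \<in> carrier G" for g
        using that a by (simp add: iff inv_mult_group m_assoc)
      then show ?thesis using a S by (simp add: iff subgroup.m_inv_closed)
    qed
    show "a \<otimes> b \<in> core G S" if a: "a \<in> core G S" and b: "b \<in> core G S" for a b
    proof -
      have "g \<otimes> (a \<otimes> b) \<otimes> inv g = (g \<otimes> a \<otimes> inv g) \<otimes> (g \<otimes> b \<otimes> inv g)" if "g \<in> carrier G" for g
        using that a b by (simp add: iff m_assoc inv_mult_cancel)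
      then show ?thesis using a b S by (simp add: iff subgroup.m_closed)
    qed
  qed (auto simp: iff)
  moreover have "k \<otimes> x \<otimes> inv k \<in> core G S" if k: "k \<in> carrier G" and x: "x \<in> core G S" for k x
  proof -
    have "g \<otimes> (k \<otimes> x \<otimes> inv k) \<otimes> inv g = (g \<otimes> k) \<otimes> x \<otimes> inv (g \<otimes> k)" if "g \<in> carrier G" for g
      using that k x by (simp add: iff inv_mult_group m_assoc)
    then show ?thesis using k x by (simp add: iff)
  qed
  ultimately show ?thesis by (rule normal_invI)
qed

lemma rcoset_eq_iff:
  assumes "subgroup S G" "x \<in> carrier G" "y \<in> carrier G"
  shows "S #> x = S #> y \<longleftrightarrow> x \<otimes> inv y \<in> S"
  using assms subgroup.rcos_module[OF assms(1) is_group, of y x] repr_independence[of x S y]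
    rcos_self[of x S] by auto

text \<open>The cosets of s and of a power of x coincide exactly when s times the inverse of that
  power lies in the core, so cyclicity of the quotient becomes a condition on elements of S. It can
  then be pushed through a homomorphism without building a map between quotient groups.\<close>

lemma core_cyclic_iff:
  assumes S: "subgroup S G"
  shows "core_cyclic G S \<longleftrightarrow> (\<exists>x\<in>S. \<forall>s\<in>S. \<exists>n::int. s \<otimes> inv (x [^] n) \<in> core G S)"
proof -
  let ?S = "G\<lparr>carrier := S\<rparr>" and ?C = "core G S"
  have sub: "S \<subseteq> carrier G" using S by (rule subgroup.subset)
  have gS: "group ?S" using S by (rule subgroup_imp_group)
  interpret C: normal ?C G using S by (rule normal_core)
  interpret CS: normal ?C ?S
    using normal_restrict_supergroup[OF S normal_core[OF S] core_subset[OF sub]] .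
  interpret Q: group "?S Mod ?C" by (rule CS.factorgroup_is_group)
  have car: "carrier (?S Mod ?C) = (\<lambda>x. ?C #> x) ` S"
    by (auto simp: carrier_FactGroup r_coset_def)
  have pow: "(?C #> x) [^]\<^bsub>?S Mod ?C\<^esub> n = ?C #> (x [^] n)" if "x \<in> S" for x and n :: int
    using CS.FactGroup_int_pow[OF _ , of x n] that int_pow_consistent[OF S that]
    by (simp add: r_coset_def)
  have powS: "x [^] n \<in> S" if "x \<in> S" for x and n :: int
    using S that by (rule subgroup_int_pow_closed)
  have eq: "?C #> s = ?C #> t \<longleftrightarrow> s \<otimes> inv t \<in> ?C" if "s \<in> S" "t \<in> S" for s t
    using that sub by (intro rcoset_eq_iff C.subgroup_axioms) auto
  show ?thesis
    unfolding core_cyclic_def Q.cyclic_group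
  proof (intro iffI; clarify)
    fix X assume X: "X \<in> carrier (?S Mod ?C)"
      and r: "carrier (?S Mod ?C) = range (\<lambda>n::int. X [^]\<^bsub>?S Mod ?C\<^esub> n)"
    obtain x where x: "x \<in> S" "X = ?C #> x" using X by (auto simp: car)
    have "\<exists>n::int. s \<otimes> inv (x [^] n) \<in> ?C" if s: "s \<in> S" for s
    proof -
      have "?C #> s \<in> range (\<lambda>n::int. X [^]\<^bsub>?S Mod ?C\<^esub> n)" using s r car by blast
      then show ?thesis using x s by (auto simp: pow eq powS)
    qed
    then show "\<exists>x\<in>S. \<forall>s\<in>S. \<exists>n::int. s \<otimes> inv (x [^] n) \<in> ?C" using x by blast
  next
    fix x assume x: "x \<in> S" and r: "\<forall>s\<in>S. \<exists>n::int. s \<otimes> inv (x [^] n) \<in> ?C"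
    show "\<exists>X\<in>carrier (?S Mod ?C). carrier (?S Mod ?C) = range (\<lambda>n::int. X [^]\<^bsub>?S Mod ?C\<^esub> n)"
    proof (intro bexI[of _ "?C #> x"] equalityI subsetI)
      fix Y assume "Y \<in> carrier (?S Mod ?C)"
      then obtain s where s: "s \<in> S" "Y = ?C #> s" by (auto simp: car)
      then obtain n :: int where "s \<otimes> inv (x [^] n) \<in> ?C" using r by blast
      then have "Y = (?C #> x) [^]\<^bsub>?S Mod ?C\<^esub> n" using s x by (simp add: pow eq powS)
      then show "Y \<in> range (\<lambda>n::int. (?C #> x) [^]\<^bsub>?S Mod ?C\<^esub> n)" by blast
    qed (use x in \<open>auto simp: car pow powS\<close>)
  qed
qed

end

section \<open>Core-cyclic subgroups under surjective homomorphisms and conjugation\<close>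

context group_hom
begin

lemma conj_by_image:
  assumes "g \<in> carrier G" "S \<subseteq> carrier G"
  shows "conj_by H (h g) (h ` S) = h ` conj_by G g S"
  unfolding G.conj_by_eq_image H.conj_by_eq_image image_image
  using assms by (intro image_cong) (auto simp: subset_iff)

lemma conj_class_image:
  assumes "h ` carrier G = carrier H" "S \<subseteq> carrier G"
  shows "conj_class H (h ` S) = image h ` conj_class G S"
  unfolding conj_class_def assms(1)[symmetric] image_image
  using assms(2) by (intro image_cong) (auto simp: conj_by_image)

lemma core_cyclic_image:
  assumes surj: "h ` carrier G = carrier H" and S: "subgroup S G" and "core_cyclic G S"
  shows "core_cyclic H (h ` S)"
proof -
  have sub: "S \<subseteq> carrier G" using S by (rule subgroup.subset)
  have hS: "subgroup (h ` S) H" using S by (rule subgroup_img_is_subgroup)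
  obtain x where x: "x \<in> S" "\<forall>s\<in>S. \<exists>n::int. s \<otimes> inv (x [^] n) \<in> core G S"
    using assms by (auto simp: G.core_cyclic_iff)
  have xc: "x \<in> carrier G" using x sub by auto
  have core: "h y \<in> core H (h ` S)" if y: "y \<in> core G S" for y
  proof -
    have yc: "y \<in> carrier G" using y by (simp add: G.mem_core_iff[OF sub])
    have "h g \<otimes>\<^bsub>H\<^esub> h y \<otimes>\<^bsub>H\<^esub> inv\<^bsub>H\<^esub> h g \<in> h ` S" if g: "g \<in> carrier G" for g
    proof (rule image_eqI)
      show "h g \<otimes>\<^bsub>H\<^esub> h y \<otimes>\<^bsub>H\<^esub> inv\<^bsub>H\<^esub> h g = h (g \<otimes> y \<otimes> inv g)"
        using g yc by simp
    qed (use y g in \<open>simp add: G.mem_core_iff[OF sub]\<close>)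
    then show ?thesis
      using yc unfolding H.mem_core_iff[OF subgroup.subset[OF hS]] surj[symmetric] by simp
  qed
  have "\<exists>n::int. h s \<otimes>\<^bsub>H\<^esub> inv\<^bsub>H\<^esub> (h x [^]\<^bsub>H\<^esub> n) \<in> core H (h ` S)" if s: "s \<in> S" for s
  proof -
    obtain n :: int where n: "s \<otimes> inv (x [^] n) \<in> core G S" using x s by blast
    have "h (s \<otimes> inv (x [^] n)) = h s \<otimes>\<^bsub>H\<^esub> inv\<^bsub>H\<^esub> (h x [^]\<^bsub>H\<^esub> n)"
      using s sub xc by (simp add: subset_iff hom_int_pow)
    then show ?thesis using core[OF n] by auto
  qed
  then show ?thesis using x by (auto simp: H.core_cyclic_iff[OF hS])
qed

text \<open>If h(y) = h(s) then y s^-1 lies in the kernel: a subgroup containing the kernel is a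
  union of fibres of \<open>h\<close>.\<close>

lemma mem_if_image_mem:
  assumes S: "subgroup S G" and ker: "kernel G H h \<subseteq> S"
    and y: "y \<in> carrier G" "h y \<in> h ` S"
  shows "y \<in> S"
proof -
  obtain s where s: "s \<in> S" "h y = h s" using y by auto
  have sc: "s \<in> carrier G" using S s(1) by (rule subgroup.mem_carrier)
  have "y \<otimes> inv s \<in> kernel G H h" using y s sc by (simp add: kernel_def)
  then have "y \<otimes> inv s \<in> S" using ker ..
  then have "(y \<otimes> inv s) \<otimes> s \<in> S" using s(1) by (rule subgroup.m_closed[OF S])
  then show ?thesis using y sc by (simp add: G.m_assoc)
qed

lemma eq_of_image_eq:
  assumes S: "subgroup S G" and T: "subgroup T G"
    and ker: "kernel G H h \<subseteq> S" "kernel G H h \<subseteq> T" and eq: "h ` S = h ` T"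
  shows "S = T"
proof
  show "S \<subseteq> T"
    using subgroup.subset[OF S] eq by (auto intro!: mem_if_image_mem[OF T ker(2)])
  show "T \<subseteq> S"
    using subgroup.subset[OF T] eq by (auto intro!: mem_if_image_mem[OF S ker(1)])
qed

lemma core_cyclic_image_iff:
  assumes surj: "h ` carrier G = carrier H" and S: "subgroup S G" and ker: "kernel G H h \<subseteq> S"
  shows "core_cyclic H (h ` S) \<longleftrightarrow> core_cyclic G S"
proof
  assume cc: "core_cyclic H (h ` S)"
  have sub: "S \<subseteq> carrier G" using S by (rule subgroup.subset)
  have hS: "subgroup (h ` S) H" using S by (rule subgroup_img_is_subgroup)
  obtain x where x: "x \<in> S"
    "\<forall>s\<in>S. \<exists>n::int. h s \<otimes>\<^bsub>H\<^esub> inv\<^bsub>H\<^esub> (h x [^]\<^bsub>H\<^esub> n) \<in> core H (h ` S)"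
    using cc by (auto simp: H.core_cyclic_iff[OF hS])
  have xc: "x \<in> carrier G" using x sub by auto
  note mem = mem_if_image_mem[OF S ker]
  have core: "y \<in> core G S" if y: "y \<in> carrier G" "h y \<in> core H (h ` S)" for y
  proof -
    have "g \<otimes> y \<otimes> inv g \<in> S" if g: "g \<in> carrier G" for g
    proof (rule mem)
      have "h g \<otimes>\<^bsub>H\<^esub> h y \<otimes>\<^bsub>H\<^esub> inv\<^bsub>H\<^esub> h g \<in> h ` S"
        using y g by (simp add: H.mem_core_iff[OF subgroup.subset[OF hS]])
      then show "h (g \<otimes> y \<otimes> inv g) \<in> h ` S" using y g by simp
    qed (use y g in auto)
    then show ?thesis using y by (simp add: G.mem_core_iff[OF sub])
  qed
  have "\<exists>n::int. s \<otimes> inv (x [^] n) \<in> core G S" if s: "s \<in> S" for s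
  proof -
    obtain n :: int where n: "h s \<otimes>\<^bsub>H\<^esub> inv\<^bsub>H\<^esub> (h x [^]\<^bsub>H\<^esub> n) \<in> core H (h ` S)" using x s by blast
    have "h (s \<otimes> inv (x [^] n)) = h s \<otimes>\<^bsub>H\<^esub> inv\<^bsub>H\<^esub> (h x [^]\<^bsub>H\<^esub> n)"
      using s sub xc by (simp add: subset_iff hom_int_pow)
    then have "s \<otimes> inv (x [^] n) \<in> core G S"
      using n s sub xc by (intro core) (auto simp: subset_iff)
    then show ?thesis ..
  qed
  then show "core_cyclic G S" using x by (auto simp: G.core_cyclic_iff[OF S])
qed (rule core_cyclic_image[OF surj S])

end

context group
begin

text \<open>Conjugation is a surjective endomorphism, so it preserves core-cyclicity; conjugating by
  the inverse gives the converse.\<close>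

lemma core_cyclic_conj_by_iff:
  assumes g: "g \<in> carrier G" and S: "subgroup S G"
  shows "core_cyclic G (conj_by G g S) \<longleftrightarrow> core_cyclic G S"
proof -
  have imp: "core_cyclic G (conj_by G k T)"
    if "k \<in> carrier G" "subgroup T G" "core_cyclic G T" for k T
    using group_hom.core_cyclic_image[OF conj_hom conj_surj] that by (simp add: conj_by_eq_image)
  show ?thesis
    using imp[OF g S] imp[OF _ subgroup_conj_by[OF g S], of "inv g"] g S
    by (auto simp: conj_by_inv_conj_by subgroup.subset)
qed

text \<open>Core-cyclicity is constant on a conjugacy class, so any representative decides whether
  the class indexes a coordinate of \<open>V G\<close>.\<close>

lemma conj_class_mem_Sub_ncc_classes_iff:
  assumes S: "subgroup S G"
  shows "conj_class G S \<in> Sub_ncc_classes G \<longleftrightarrow> \<not> core_cyclic G S"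
proof
  assume "conj_class G S \<in> Sub_ncc_classes G"
  then obtain T where T: "subgroup T G" "\<not> core_cyclic G T" "conj_class G S = conj_class G T"
    by (auto simp: Sub_ncc_classes_def Sub_ncc_def)
  then have "S \<in> conj_class G T" using S mem_conj_class subgroup.subset by metis
  then show "\<not> core_cyclic G S" using T by (auto simp: conj_class_def core_cyclic_conj_by_iff)
qed (use S in \<open>auto simp: Sub_ncc_classes_def Sub_ncc_def\<close>)

lemma ext0_conj_class:
  "subgroup S G \<Longrightarrow>
    ext0 G x (conj_class G S) = (if core_cyclic G S then 0 else x (conj_class G S))"
  by (simp add: ext0_def conj_class_mem_Sub_ncc_classes_iff)

end

section \<open>Class functions modulo homomorphisms\<close>

lemma carrier_Cl0:
  "carrier (Cl0 W) = {f \<in> carrier W \<rightarrow>\<^sub>E UNIV. f \<one>\<^bsub>W\<^esub> = 0 \<and>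
     (\<forall>u\<in>carrier W. \<forall>v\<in>carrier W. f (u \<otimes>\<^bsub>W\<^esub> v \<otimes>\<^bsub>W\<^esub> inv\<^bsub>W\<^esub> u) = f v)}"
  by (simp add: Cl0_def)

lemma mult_Cl0: "f \<otimes>\<^bsub>Cl0 W\<^esub> g = (\<lambda>w\<in>carrier W. f w + g w)"
  by (simp add: Cl0_def)

lemma one_Cl0: "\<one>\<^bsub>Cl0 W\<^esub> = (\<lambda>w\<in>carrier W. 0)"
  by (simp add: Cl0_def)

context group
begin

lemma Cl0_self_inverse: "f \<otimes>\<^bsub>Cl0 G\<^esub> f = \<one>\<^bsub>Cl0 G\<^esub>"
  by (simp add: mult_Cl0 one_Cl0)

lemma comm_group_Cl0: "comm_group (Cl0 G)"
proof (rule comm_groupI)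
  show "f \<otimes>\<^bsub>Cl0 G\<^esub> g \<in> carrier (Cl0 G)" if "f \<in> carrier (Cl0 G)" "g \<in> carrier (Cl0 G)" for f g
    using that by (simp add: carrier_Cl0 mult_Cl0)
  show "\<one>\<^bsub>Cl0 G\<^esub> \<in> carrier (Cl0 G)"
    by (simp add: carrier_Cl0 one_Cl0)
  show "\<one>\<^bsub>Cl0 G\<^esub> \<otimes>\<^bsub>Cl0 G\<^esub> f = f" if "f \<in> carrier (Cl0 G)" for f
    using that by (auto simp: carrier_Cl0 mult_Cl0 one_Cl0 fun_eq_iff PiE_iff extensional_def)
  show "\<exists>g\<in>carrier (Cl0 G). g \<otimes>\<^bsub>Cl0 G\<^esub> f = \<one>\<^bsub>Cl0 G\<^esub>" if "f \<in> carrier (Cl0 G)" for f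
    using that Cl0_self_inverse by blast
qed (auto simp: mult_Cl0 add_ac fun_eq_iff)

lemma group_Cl0: "group (Cl0 G)"
  using comm_group_Cl0 by (rule comm_group.axioms)

lemma inv_Cl0: "f \<in> carrier (Cl0 G) \<Longrightarrow> inv\<^bsub>Cl0 G\<^esub> f = f"
  using group.inv_equality[OF group_Cl0 Cl0_self_inverse] by blast

lemma HomF2_iff:
  "f \<in> HomF2 G \<longleftrightarrow>
    f \<in> extensional (carrier G) \<and> (\<forall>x\<in>carrier G. \<forall>y\<in>carrier G. f (x \<otimes> y) = f x + f y)"
  by (auto simp: HomF2_def hom_def)

text \<open>The target is abelian, so a homomorphism into it is invariant under conjugation and
  vanishes at the identity.\<close>

lemma HomF2_subset_Cl0: "HomF2 G \<subseteq> carrier (Cl0 G)"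
proof
  fix f assume f: "f \<in> HomF2 G"
  then interpret group_hom G F2 f
    by (intro group_hom.intro group_hom_axioms.intro is_group group_F2) (simp add: HomF2_def)
  show "f \<in> carrier (Cl0 G)"
    using f hom_one hom_mult hom_inv by (simp add: carrier_Cl0 HomF2_def PiE_iff add_ac)
qed

lemma HomF2_normal: "HomF2 G \<lhd> Cl0 G"
proof (rule comm_group.subgroup_imp_normal[OF comm_group_Cl0])
  show "subgroup (HomF2 G) (Cl0 G)"
  proof (rule group.subgroupI[OF group_Cl0 HomF2_subset_Cl0])
    have "(\<lambda>w\<in>carrier G. 0) \<in> HomF2 G"
      by (simp add: HomF2_iff)
    then show "HomF2 G \<noteq> {}" by blast
    show "inv\<^bsub>Cl0 G\<^esub> f \<in> HomF2 G" if "f \<in> HomF2 G" for f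
      using that HomF2_subset_Cl0 by (auto simp: inv_Cl0)
    show "f \<otimes>\<^bsub>Cl0 G\<^esub> g \<in> HomF2 G" if "f \<in> HomF2 G" "g \<in> HomF2 G" for f g
      using that by (simp add: HomF2_iff mult_Cl0 add_ac)
  qed
qed

lemma HomF2_subgroup: "subgroup (HomF2 G) (Cl0 G)"
  using HomF2_normal by (rule normal.axioms)

lemma group_defect: "group (defect G)"
  unfolding defect_def using HomF2_normal by (rule normal.factorgroup_is_group)

lemma carrier_defect: "carrier (defect G) = dclass G ` carrier (Cl0 G)"
  by (simp add: defect_def carrier_FactGroup dclass_def[abs_def])

lemma dclass_mult:
  "f \<in> carrier (Cl0 G) \<Longrightarrow> g \<in> carrier (Cl0 G) \<Longrightarrow>
    dclass G f \<otimes>\<^bsub>defect G\<^esub> dclass G g = dclass G (f \<otimes>\<^bsub>Cl0 G\<^esub> g)"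
  by (simp add: defect_def dclass_def normal.rcos_sum[OF HomF2_normal])

text \<open>\<open>Cl0 G\<close> has exponent two, so the product of \<open>f\<close> and
  \<open>g\<close> is also their quotient.\<close>

lemma dclass_eq_iff:
  "f \<in> carrier (Cl0 G) \<Longrightarrow> g \<in> carrier (Cl0 G) \<Longrightarrow>
    dclass G f = dclass G g \<longleftrightarrow> f \<otimes>\<^bsub>Cl0 G\<^esub> g \<in> HomF2 G"
  by (simp add: dclass_def group.rcoset_eq_iff[OF group_Cl0 HomF2_subgroup] inv_Cl0)

lemma dclass_memD:
  assumes "f \<in> carrier (Cl0 G)" "f' \<in> dclass G f"
  shows "f' \<in> carrier (Cl0 G)" "dclass G f' = dclass G f"
proof -
  show "f' \<in> carrier (Cl0 G)"
    using assms monoid.r_coset_subset_G[OF group.is_monoid[OF group_Cl0] HomF2_subset_Cl0]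
    by (auto simp: dclass_def)
  show "dclass G f' = dclass G f"
    using assms group.repr_independence[OF group_Cl0 _ _ HomF2_subgroup] by (simp add: dclass_def)
qed

lemma dclass_self: "f \<in> carrier (Cl0 G) \<Longrightarrow> f \<in> dclass G f"
  unfolding dclass_def using group.rcos_self[OF group_Cl0 _ HomF2_subgroup] .

end

context group_hom
begin

lemma compose_Cl0:
  "f \<in> carrier (Cl0 H) \<Longrightarrow> compose (carrier G) f h \<in> carrier (Cl0 G)"
  by (simp add: carrier_Cl0 compose_def)

text \<open>By surjectivity, additivity of the composite on pairs from \<open>G\<close> tests
  additivity of \<open>f\<close> on all pairs from \<open>H\<close>.\<close>

lemma compose_HomF2_iff:
  assumes "f \<in> extensional (carrier H)" "h ` carrier G = carrier H"
  shows "compose (carrier G) f h \<in> HomF2 G \<longleftrightarrow> f \<in> HomF2 H"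
  using assms(1) unfolding G.HomF2_iff H.HomF2_iff assms(2)[symmetric] by (simp add: compose_def)

lemma compose_HomF2: "f \<in> HomF2 H \<Longrightarrow> compose (carrier G) f h \<in> HomF2 G"
  by (simp add: G.HomF2_iff H.HomF2_iff compose_def)

lemma compose_mult_Cl0:
  "compose (carrier G) (f \<otimes>\<^bsub>Cl0 H\<^esub> g) h
    = compose (carrier G) f h \<otimes>\<^bsub>Cl0 G\<^esub> compose (carrier G) g h"
  by (auto simp: compose_def mult_Cl0)

text \<open>Members of one coset differ by a homomorphism, and its composite with \<open>h\<close>
  is again a homomorphism. Hence all members give the same class, and \<open>the_elem\<close>
  returns it.\<close>

lemma pullback_dclass:
  assumes f: "f \<in> carrier (Cl0 H)"
  shows "pullback G h (dclass H f) = dclass G (compose (carrier G) f h)"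
  unfolding pullback_def
proof (rule the_elem_image_unique)
  show "dclass H f \<noteq> {}" using H.dclass_self[OF f] by blast
  show "dclass G (compose (carrier G) f' h) = dclass G (compose (carrier G) f h)"
    if "f' \<in> dclass H f" for f'
    using H.dclass_memD[OF f that] f
    by (simp add: G.dclass_eq_iff H.dclass_eq_iff compose_Cl0 compose_HomF2 flip: compose_mult_Cl0)
qed

text \<open>If the pullbacks of two classes agree, the composite of f + g with \<open>h\<close> is a
  homomorphism, and surjectivity makes f + g one. This is what turns \<open>inv_into\<close> in
  \<open>Fix_D\<close> into a left inverse of the pullback.\<close>

lemma inj_on_pullback:
  assumes surj: "h ` carrier G = carrier H"
  shows "inj_on (pullback G h) (carrier (defect H))"
proof (rule inj_onI)
  fix X Y assume "X \<in> carrier (defect H)" "Y \<in> carrier (defect H)"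
    and eq: "pullback G h X = pullback G h Y"
  then obtain f g where f: "f \<in> carrier (Cl0 H)" "X = dclass H f"
    and g: "g \<in> carrier (Cl0 H)" "Y = dclass H g"
    by (auto simp: H.carrier_defect)
  have "compose (carrier G) (f \<otimes>\<^bsub>Cl0 H\<^esub> g) h \<in> HomF2 G"
    using eq f g by (simp add: pullback_dclass G.dclass_eq_iff compose_Cl0 compose_mult_Cl0)
  then have "f \<otimes>\<^bsub>Cl0 H\<^esub> g \<in> HomF2 H"
    using surj by (subst (asm) compose_HomF2_iff) (simp_all add: mult_Cl0)
  then show "X = Y" using f g by (simp add: H.dclass_eq_iff)
qed

end

section \<open>Weyl groups\<close>

context group
begin

lemma mem_normalizer_iff:
  "S \<subseteq> carrier G \<Longrightarrow> g \<in> normalizer G S \<longleftrightarrow> g \<in> carrier G \<and> conj_by G g S = S"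
  by (simp add: normalizer_def stabilizer_def conj_by_def)

lemma one_Weyl: "\<one>\<^bsub>Weyl G S\<^esub> = S"
  by (simp add: Weyl_def)

lemma carrier_Weyl: "carrier (Weyl G S) = (\<lambda>g. S #> g) ` normalizer G S"
  by (simp add: Weyl_def carrier_FactGroup r_coset_def)

lemma group_Weyl:
  assumes "subgroup S G"
  shows "group (Weyl G S)"
  unfolding Weyl_def using subgroup_in_normalizer[OF assms] by (rule normal.factorgroup_is_group)

lemma subgroup_normalizer: "subgroup S G \<Longrightarrow> subgroup (normalizer G S) G"
  by (simp add: normalizer_imp_subgroup subgroup.subset)

lemma mult_Weyl:
  assumes S: "subgroup S G" and "a \<in> normalizer G S" "b \<in> normalizer G S"
  shows "(S #> a) \<otimes>\<^bsub>Weyl G S\<^esub> (S #> b) = S #> (a \<otimes> b)"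
  using normal.rcos_sum[OF subgroup_in_normalizer[OF S], of a b] assms
  by (simp add: Weyl_def r_coset_def set_mult_def)

lemma inv_Weyl:
  assumes S: "subgroup S G" and a: "a \<in> normalizer G S"
  shows "inv\<^bsub>Weyl G S\<^esub> (S #> a) = S #> inv a"
proof -
  note N = subgroup_normalizer[OF S]
  have ia: "inv a \<in> normalizer G S" using N a by (rule subgroup.m_inv_closed)
  have ac: "a \<in> carrier G" using N a by (rule subgroup.mem_carrier)
  show ?thesis
    using a ia ac by (intro group.inv_equality[OF group_Weyl[OF S]])
      (auto simp: mult_Weyl[OF S] one_Weyl carrier_Weyl coset_mult_one subgroup.subset[OF S])
qed

end

section \<open>Functoriality of Weyl groups\<close>

lemma (in group_hom) image_rcoset:
  assumes "S \<subseteq> carrier G" "g \<in> carrier G"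
  shows "h ` (S #> g) = h ` S #>\<^bsub>H\<^esub> h g"
proof -
  have "S #> g = (\<lambda>s. s \<otimes> g) ` S" and "h ` S #>\<^bsub>H\<^esub> h g = (\<lambda>s. h s \<otimes>\<^bsub>H\<^esub> h g) ` S"
    by (auto simp: r_coset_def)
  then show ?thesis
    using assms by (auto simp: image_image subset_iff intro!: image_cong)
qed

lemma (in group_hom) normalizer_image:
  assumes "subgroup S G" "g \<in> normalizer G S"
  shows "h g \<in> normalizer H (h ` S)"
  using assms subgroup.subset[OF subgroup_img_is_subgroup[OF assms(1)]]
  by (simp add: G.mem_normalizer_iff H.mem_normalizer_iff subgroup.subset conj_by_image)

text \<open>The image of the coset S g as a set is the coset of h(g) modulo h(S), and h(g)
  normalizes h(S) when g normalizes S. Working with images of sets avoids any choice of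
  representatives.\<close>

lemma (in group_hom) Weyl_hom:
  assumes S: "subgroup S G"
  shows "group_hom (Weyl G S) (Weyl H (h ` S)) (image h)"
proof (intro group_hom.intro group_hom_axioms.intro homI)
  have hS: "subgroup (h ` S) H" using S by (rule subgroup_img_is_subgroup)
  show "group (Weyl G S)" "group (Weyl H (h ` S))"
    using G.group_Weyl[OF S] H.group_Weyl[OF hS] .
  note N = G.subgroup_normalizer[OF S]
  have img: "h ` (S #> g) = h ` S #>\<^bsub>H\<^esub> h g" if "g \<in> normalizer G S" for g
    using that S N by (simp add: image_rcoset subgroup.subset subgroup.mem_carrier)
  show "h ` C \<in> carrier (Weyl H (h ` S))" if "C \<in> carrier (Weyl G S)" for C
    using that normalizer_image[OF S] by (auto simp: G.carrier_Weyl H.carrier_Weyl img)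
  fix C D assume "C \<in> carrier (Weyl G S)" "D \<in> carrier (Weyl G S)"
  then obtain a b where a: "a \<in> normalizer G S" "C = S #> a" and b: "b \<in> normalizer G S" "D = S #> b"
    by (auto simp: G.carrier_Weyl)
  have "a \<in> carrier G" "b \<in> carrier G" "a \<otimes> b \<in> normalizer G S"
    using a b N by (simp_all add: subgroup.mem_carrier subgroup.m_closed)
  then show "h ` (C \<otimes>\<^bsub>Weyl G S\<^esub> D) = h ` C \<otimes>\<^bsub>Weyl H (h ` S)\<^esub> h ` D"
    using a b normalizer_image[OF S] by (simp add: G.mult_Weyl[OF S] H.mult_Weyl[OF hS] img)
qed

text \<open>Take g over an element normalizing h(S). Then S and g S g^-1 have the same image and
  both contain the kernel, so they are equal and g normalizes S.\<close>

lemma (in group_hom) Weyl_surj: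
  assumes surj: "h ` carrier G = carrier H" and S: "subgroup S G" and ker: "kernel G H h \<subseteq> S"
  shows "image h ` carrier (Weyl G S) = carrier (Weyl H (h ` S))"
proof
  have hS: "subgroup (h ` S) H" using S by (rule subgroup_img_is_subgroup)
  have sub: "S \<subseteq> carrier G" using S by (rule subgroup.subset)
  interpret W: group_hom "Weyl G S" "Weyl H (h ` S)" "image h" using S by (rule Weyl_hom)
  show "image h ` carrier (Weyl G S) \<subseteq> carrier (Weyl H (h ` S))" by auto
  show "carrier (Weyl H (h ` S)) \<subseteq> image h ` carrier (Weyl G S)"
  proof
    fix C assume "C \<in> carrier (Weyl H (h ` S))"
    then obtain g' where g': "g' \<in> normalizer H (h ` S)" "C = h ` S #>\<^bsub>H\<^esub> g'"
      by (auto simp: H.carrier_Weyl)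
    then have "g' \<in> carrier H" by (simp add: H.mem_normalizer_iff subgroup.subset[OF hS])
    then obtain g where g: "g \<in> carrier G" "g' = h g" using surj by auto
    have "h ` conj_by G g S = h ` S"
      using g g' sub by (simp add: H.mem_normalizer_iff subgroup.subset[OF hS] conj_by_image)
    \<comment> \<open>The kernel is normal, so it lies in each conjugate of
      \<open>S\<close>.\<close>
    moreover have "kernel G H h \<subseteq> conj_by G g S"
    proof
      fix x assume x: "x \<in> kernel G H h"
      then have "inv g \<otimes> x \<otimes> g \<in> S" using g ker by (auto simp: kernel_def)
      moreover have "x = g \<otimes> (inv g \<otimes> x \<otimes> g) \<otimes> inv g"
        using x g by (simp add: kernel_def G.m_assoc G.inv_mult_cancel)
      ultimately show "x \<in> conj_by G g S" unfolding G.conj_by_eq_image by blast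
    qed
    ultimately have "conj_by G g S = S"
      using eq_of_image_eq[OF S G.subgroup_conj_by[OF g(1) S]] ker by simp
    then have "g \<in> normalizer G S" using g sub by (simp add: G.mem_normalizer_iff)
    then have "S #> g \<in> carrier (Weyl G S)" by (auto simp: G.carrier_Weyl)
    moreover have "C = h ` (S #> g)" using g g' sub by (simp add: image_rcoset)
    ultimately show "C \<in> image h ` carrier (Weyl G S)" by blast
  qed
qed

section \<open>The defect map\<close>

lemma V_simps:
  "carrier (V G) = Sub_ncc_classes G \<rightarrow>\<^sub>E UNIV"
  "x \<otimes>\<^bsub>V G\<^esub> y = (\<lambda>c\<in>Sub_ncc_classes G. x c + y c)"
  by (simp_all add: V_def)

lemma group_V: "group (V G)"
  by (simp add: V_def)

lemma ext0_mult: "ext0 G (x \<otimes>\<^bsub>V G\<^esub> y) c = ext0 G x c + ext0 G y c"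
  by (simp add: ext0_def V_simps)

context group
begin

text \<open>An element s g of the coset lies in the subgroup generated by S and g; the coset
  relation is symmetric, which gives the other inclusion. This makes \<open>lam\<close> independent
  of the representative of a coset.\<close>

lemma generate_insert_rcoset:
  assumes S: "subgroup S G" and g: "g \<in> carrier G" and g': "g' \<in> S #> g"
  shows "generate G (insert g' S) = generate G (insert g S)"
proof -
  have sub: "S \<subseteq> carrier G" using S by (rule subgroup.subset)
  have incl: "generate G (insert b S) \<subseteq> generate G (insert a S)"
    if a: "a \<in> carrier G" and b: "b \<in> S #> a" for a b
  proof -
    have gen: "subgroup (generate G (insert a S)) G"
      using a sub by (intro generate_is_subgroup) auto
    obtain s where s: "s \<in> S" "b = s \<otimes> a" using b by (auto simp: r_coset_def)
    have mem: "c \<in> generate G (insert a S)" if "c \<in> insert a S" for c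
      using that by (rule generate.incl)
    have "b \<in> generate G (insert a S)"
      unfolding s(2) using s(1) by (intro subgroup.m_closed[OF gen] mem) auto
    then show ?thesis using mem by (intro generate_subgroup_incl[OF _ gen]) auto
  qed
  have "g' \<in> carrier G" using r_coset_subset_G[OF sub g] g' by auto
  moreover have "g \<in> S #> g'"
    using repr_independence[OF g' g S] rcos_self[OF g S] by simp
  ultimately show ?thesis using incl g g' by blast
qed

lemma lam_rcoset:
  assumes S: "subgroup S G" and g: "g \<in> normalizer G S"
  shows "lam G x S (S #> g)
    = ext0 G x (conj_class G (generate G (insert g S))) + ext0 G x (conj_class G S)"
proof -
  have gc: "g \<in> carrier G" using subgroup_normalizer[OF S] g by (rule subgroup.mem_carrier)
  have "S #> g \<in> carrier (Weyl G S)" using g by (auto simp: carrier_Weyl)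
  moreover have "S #> g \<noteq> {}" using rcos_self[OF gc S] by blast
  ultimately show ?thesis
    unfolding lam_def restrict_def
    by (simp, intro the_elem_image_unique) (simp_all only: generate_insert_rcoset[OF S gc])
qed

end

text \<open>The subgroup generated by h(S) and h(g) is the image of the one generated by S and g, so
  only subgroups above S and their images enter. Asking for agreement only there is essential for
  fixed points, where it is available just for subgroups containing the kernel.\<close>

lemma (in group_hom) lam_image:
  assumes S: "subgroup S G"
    and eq: "\<And>T. subgroup T G \<Longrightarrow> S \<subseteq> T \<Longrightarrow>
      ext0 G x (conj_class G T) = ext0 H y (conj_class H (h ` T))"
  shows "lam G x S = compose (carrier (Weyl G S)) (lam H y (h ` S)) (image h)"
proof -
  have sub: "S \<subseteq> carrier G" using S by (rule subgroup.subset)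
  have hS: "subgroup (h ` S) H" using S by (rule subgroup_img_is_subgroup)
  have "lam G x S (S #> g) = lam H y (h ` S) (h ` (S #> g))" if g: "g \<in> normalizer G S" for g
  proof -
    have gc: "g \<in> carrier G" using G.subgroup_normalizer[OF S] g by (rule subgroup.mem_carrier)
    have gen: "subgroup (generate G (insert g S)) G"
      using gc sub by (intro G.generate_is_subgroup) auto
    have "S \<subseteq> generate G (insert g S)" by (auto intro: generate.incl)
    moreover have "h ` generate G (insert g S) = generate H (insert (h g) (h ` S))"
      using generate_img[of "insert g S"] gc sub by simp
    ultimately show ?thesis
      using eq[OF S] eq[OF gen] gc sub
      by (simp add: image_rcoset G.lam_rcoset[OF S g] H.lam_rcoset[OF hS normalizer_image[OF S g]])
  qed
  then show ?thesis
    unfolding compose_def by (intro ext) (auto simp: G.carrier_Weyl lam_def)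
qed

context group
begin

text \<open>This is \<open>lam_image\<close> for conjugation with the same vector on both sides: a
  subgroup and its conjugate have the same class.\<close>

lemma lam_conj:
  assumes g: "g \<in> carrier G" and S: "subgroup S G"
  shows "lam G x S = compose (carrier (Weyl G S)) (lam G x (conj_by G g S)) (conj_by G g)"
  unfolding conj_by_eq_image
  by (rule group_hom.lam_image[OF conj_hom[OF g] S])
    (simp add: g conj_class_conj_by subgroup.subset flip: conj_by_eq_image)

text \<open>For u normalizing S, conjugation by u fixes S and induces on the Weyl group conjugation
  by the coset of u. Applied to u, \<open>lam_conj\<close> then says that \<open>lam G x S\<close>
  is invariant under it.\<close>

lemma lam_Cl0:
  assumes S: "subgroup S G"
  shows "lam G x S \<in> carrier (Cl0 (Weyl G S))"
proof -
  note N = subgroup_normalizer[OF S]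
  have sub: "S \<subseteq> carrier G" using S by (rule subgroup.subset)
  have "lam G x S S = 0"
  proof -
    \<comment> \<open>At the identity coset the generated subgroup is S itself, so the two summands
      of \<open>lam\<close> are equal and cancel.\<close>
    have "insert \<one> S = S" using S by (auto simp: subgroup.one_closed)
    moreover have "generate G S = S"
      by (rule generateI[OF S order_refl, symmetric])
    ultimately show ?thesis
      using lam_rcoset[OF S subgroup.one_closed[OF N], of x] sub by (simp add: coset_mult_one)
  qed
  moreover have "lam G x S (U \<otimes>\<^bsub>Weyl G S\<^esub> C \<otimes>\<^bsub>Weyl G S\<^esub> inv\<^bsub>Weyl G S\<^esub> U) = lam G x S C"
    if U: "U \<in> carrier (Weyl G S)" and C: "C \<in> carrier (Weyl G S)" for U C
  proof -
    obtain u g where u: "u \<in> normalizer G S" "U = S #> u" and g: "g \<in> normalizer G S" "C = S #> g"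
      using U C by (auto simp: carrier_Weyl)
    have uc: "u \<in> carrier G" and gc: "g \<in> carrier G"
      using u g N by (simp_all add: subgroup.mem_carrier)
    have "inv u \<in> normalizer G S" "u \<otimes> g \<in> normalizer G S"
      using u g N by (simp_all add: subgroup.m_inv_closed subgroup.m_closed)
    then have "U \<otimes>\<^bsub>Weyl G S\<^esub> C \<otimes>\<^bsub>Weyl G S\<^esub> inv\<^bsub>Weyl G S\<^esub> U = S #> (u \<otimes> g \<otimes> inv u)"
      using u g by (simp add: mult_Weyl[OF S] inv_Weyl[OF S])
    also have fixed: "conj_by G u S = S" using u sub by (simp add: mem_normalizer_iff)
    then have "S #> (u \<otimes> g \<otimes> inv u) = conj_by G u C"
      using group_hom.image_rcoset[OF conj_hom[OF uc] sub gc] g by (simp add: conj_by_eq_image)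
    finally show ?thesis
      using fun_cong[OF lam_conj[OF uc S, of x], of C] fixed C by (simp add: compose_def)
  qed
  ultimately show ?thesis
    by (simp add: carrier_Cl0 one_Weyl) (simp add: lam_def)
qed

lemma lam_mult:
  assumes S: "subgroup S G"
  shows "lam G (x \<otimes>\<^bsub>V G\<^esub> y) S = lam G x S \<otimes>\<^bsub>Cl0 (Weyl G S)\<^esub> lam G y S"
proof -
  have "lam G (x \<otimes>\<^bsub>V G\<^esub> y) S C = lam G x S C + lam G y S C" if "C \<in> carrier (Weyl G S)" for C
    using that by (auto simp: carrier_Weyl lam_rcoset[OF S] ext0_mult add_ac)
  then show ?thesis
    unfolding mult_Cl0 by (intro ext) (simp add: lam_def)
qed

lemma Def_hom:
  assumes fin: "finite (carrier G)" and R: "class_reps G R"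
  shows "Def G R \<in> hom (V G) (DD G R)"
proof (rule homI)
  have sub: "subgroup S G" if "S \<in> R" for S
    using R that by (auto simp: class_reps_def)
  \<comment> \<open>Finiteness of \<open>R\<close> makes the finite-support condition of
    \<open>sum_group\<close> hold for every family.\<close>
  have "R \<subseteq> Pow (carrier G)" using sub subgroup.subset by blast
  then have finR: "finite R" using fin finite_subset by auto
  have grp: "group (defect (Weyl G S))" if "S \<in> R" for S
    using group.group_defect[OF group_Weyl[OF sub[OF that]]] .
  show "Def G R x \<in> carrier (DD G R)" for x
    unfolding DD_def using finR
    by (simp add: carrier_sum_group grp Def_def group.carrier_defect group_Weyl sub lam_Cl0)
  show "Def G R (x \<otimes>\<^bsub>V G\<^esub> y) = Def G R x \<otimes>\<^bsub>DD G R\<^esub> Def G R y" for x y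
    unfolding DD_def
    by (auto simp: Def_def lam_mult group.dclass_mult group_Weyl sub lam_Cl0 fun_eq_iff)
qed

text \<open>By \<open>lam_conj\<close>, transporting the class at a representative back to S gives
  the class of \<open>lam\<close> at S whichever q is used, so \<open>the_elem\<close> is applied to
  a singleton. The set of such q is nonempty because \<open>R\<close> meets every class.\<close>

lemma component_Def:
  assumes R: "class_reps G R" and S: "subgroup S G"
  shows "component G R (Def G R x) S = dclass (Weyl G S) (lam G x S)"
proof -
  have "component G R (Def G R x) S =
    the_elem ((\<lambda>q. pullback (Weyl G S) (conj_by G q) (Def G R x (conj_by G q S)))
      ` {q \<in> carrier G. conj_by G q S \<in> R})"
    unfolding component_def by (rule arg_cong[of _ _ the_elem]) auto
  also have "\<dots> = dclass (Weyl G S) (lam G x S)"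
  proof (rule the_elem_image_unique)
    have "conj_class G S \<in> Sub_classes G" using S by (simp add: Sub_classes_def)
    then obtain T where "T \<in> R" "T \<in> conj_class G S" using R unfolding class_reps_def by blast
    then show "{q \<in> carrier G. conj_by G q S \<in> R} \<noteq> {}" by (auto simp: conj_class_def)
    fix q assume "q \<in> {q \<in> carrier G. conj_by G q S \<in> R}"
    then have q: "q \<in> carrier G" "conj_by G q S \<in> R" by auto
    have "group_hom (Weyl G S) (Weyl G (conj_by G q S)) (conj_by G q)"
      using group_hom.Weyl_hom[OF conj_hom[OF q(1)] S] by (simp add: conj_by_eq_image)
    from group_hom.pullback_dclass[OF this lam_Cl0[OF subgroup_conj_by[OF q(1) S]], of x]
    show "pullback (Weyl G S) (conj_by G q) (Def G R x (conj_by G q S))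
        = dclass (Weyl G S) (lam G x S)"
      using q lam_conj[OF q(1) S, of x] by (simp add: Def_def)
  qed
  finally show ?thesis .
qed

end

section \<open>Inflation and fixed points\<close>

context normal
begin

lemma proj_hom: "group_hom G (G Mod H) (proj G H)"
  using r_coset_hom_Mod factorgroup_is_group
  by (intro group_hom.intro group_hom_axioms.intro is_group) (simp_all add: proj_def[abs_def])

lemma proj_surj: "proj G H ` carrier G = carrier (G Mod H)"
  by (simp add: proj_def[abs_def] carrier_FactGroup)

lemma kernel_proj: "kernel G (G Mod H) (proj G H) = H"
proof
  show "kernel G (G Mod H) (proj G H) \<subseteq> H"
    using rcos_self[OF _ subgroup_axioms] by (auto simp: kernel_def proj_def)
  show "H \<subseteq> kernel G (G Mod H) (proj G H)"
    by (auto simp: kernel_def proj_def coset_join2 subgroup_axioms)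
qed

end

context normal
begin

lemma mem_lift_iff: "g \<in> lift G H L \<longleftrightarrow> g \<in> carrier G \<and> proj G H g \<in> L"
  by (simp add: lift_def)

lemma subgroup_lift:
  assumes L: "subgroup L (G Mod H)"
  shows "subgroup (lift G H L) G"
proof -
  interpret p: group_hom G "G Mod H" "proj G H" by (rule proj_hom)
  show ?thesis
  proof (rule subgroupI)
    have "\<one> \<in> lift G H L"
      using p.hom_one subgroup.one_closed[OF L] by (simp add: mem_lift_iff del: one_FactGroup)
    then show "lift G H L \<noteq> {}" by blast
    show "inv a \<in> lift G H L" if "a \<in> lift G H L" for a
      using that p.hom_inv subgroup.m_inv_closed[OF L] by (simp add: mem_lift_iff)
    show "a \<otimes> b \<in> lift G H L" if "a \<in> lift G H L" "b \<in> lift G H L" for a b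
      using that p.hom_mult subgroup.m_closed[OF L] by (simp add: mem_lift_iff del: mult_FactGroup)
  qed (auto simp: mem_lift_iff)
qed

lemma subset_lift:
  assumes L: "subgroup L (G Mod H)"
  shows "H \<subseteq> lift G H L"
proof
  fix g assume "g \<in> H"
  then have "g \<in> kernel G (G Mod H) (proj G H)" by (simp add: kernel_proj)
  then show "g \<in> lift G H L"
    using subgroup.one_closed[OF L] by (simp add: mem_lift_iff kernel_def)
qed

lemma proj_lift:
  assumes L: "subgroup L (G Mod H)"
  shows "proj G H ` lift G H L = L"
proof
  show "L \<subseteq> proj G H ` lift G H L"
  proof
    fix X assume X: "X \<in> L"
    then have "X \<in> proj G H ` carrier G"
      using subgroup.subset[OF L] proj_surj by auto
    then show "X \<in> proj G H ` lift G H L" using X by (auto simp: mem_lift_iff)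
  qed
qed (auto simp: mem_lift_iff)

text \<open>A subgroup containing the kernel \<open>H\<close> is the full preimage of its image.
  With \<open>proj_lift\<close> this is the correspondence between subgroups above \<open>H\<close>
  and subgroups of the quotient.\<close>

lemma lift_proj:
  assumes S: "subgroup S G" and "H \<subseteq> S"
  shows "lift G H (proj G H ` S) = S"
proof -
  interpret p: group_hom G "G Mod H" "proj G H" by (rule proj_hom)
  show ?thesis
    using assms(2) subgroup.mem_carrier[OF S]
    by (auto simp: mem_lift_iff intro!: p.mem_if_image_mem[OF S, unfolded kernel_proj])
qed

lemma subset_conj_by:
  assumes q: "q \<in> carrier G" and "H \<subseteq> S"
  shows "H \<subseteq> conj_by G q S"
proof
  fix x assume x: "x \<in> H"
  then have "inv q \<otimes> x \<otimes> q \<in> S" using assms inv_op_closed1[OF q] by auto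
  moreover have "x = q \<otimes> (inv q \<otimes> x \<otimes> q) \<otimes> inv q"
    using x q by (simp add: m_assoc inv_mult_cancel)
  ultimately show "x \<in> conj_by G q S" unfolding conj_by_eq_image by blast
qed

lemma conj_class_proj_conj_by:
  assumes q: "q \<in> carrier G" and S: "subgroup S G"
  shows "conj_class (G Mod H) (proj G H ` conj_by G q S) = conj_class (G Mod H) (proj G H ` S)"
proof -
  interpret p: group_hom G "G Mod H" "proj G H" by (rule proj_hom)
  show ?thesis
    using q subgroup.subset[OF S] subgroup.subset[OF p.subgroup_img_is_subgroup[OF S]]
    by (simp add: p.H.conj_class_conj_by flip: p.conj_by_image)
qed

text \<open>Conjugates of S project to conjugates of the image of S, and the case distinction in
  \<open>Inf_V\<close> is the one made by \<open>ext0\<close>, so every member of the class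
  contributes the same value.\<close>

lemma Inf_V_conj_class:
  assumes S: "subgroup S G" and ncc: "\<not> core_cyclic G S"
  shows "Inf_V G H x (conj_class G S) = ext0 (G Mod H) x (conj_class (G Mod H) (proj G H ` S))"
proof -
  interpret p: group_hom G "G Mod H" "proj G H" by (rule proj_hom)
  have "(if proj G H ` T \<in> Sub_ncc (G Mod H) then x (conj_class (G Mod H) (proj G H ` T)) else 0)
      = ext0 (G Mod H) x (conj_class (G Mod H) (proj G H ` S))" if T: "T \<in> conj_class G S" for T
  proof -
    obtain q where q: "q \<in> carrier G" "T = conj_by G q S" using T by (auto simp: conj_class_def)
    have "subgroup (proj G H ` T) (G Mod H)"
      using q S by (simp add: p.subgroup_img_is_subgroup subgroup_conj_by)
    then show ?thesis
      unfolding conj_class_proj_conj_by[OF q(1) S, folded q(2), symmetric]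
      by (simp add: p.H.ext0_conj_class Sub_ncc_def)
  qed
  then show ?thesis
    using ncc mem_conj_class[OF subgroup.subset[OF S]]
    unfolding Inf_V_def
    by (subst restrict_apply')
      (auto simp: conj_class_mem_Sub_ncc_classes_iff[OF S] intro!: the_elem_image_unique)
qed

text \<open>For core-cyclic S the image is core-cyclic too, so both sides are 0; otherwise
  \<open>Inf_V_conj_class\<close> applies. This is the agreement required by
  \<open>lam_image\<close>.\<close>

lemma ext0_Inf_V:
  assumes S: "subgroup S G"
  shows "ext0 G (Inf_V G H x) (conj_class G S)
    = ext0 (G Mod H) x (conj_class (G Mod H) (proj G H ` S))"
proof -
  interpret p: group_hom G "G Mod H" "proj G H" by (rule proj_hom)
  show ?thesis
    using p.core_cyclic_image[OF proj_surj S] Inf_V_conj_class[OF S, of x]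
    by (simp add: ext0_conj_class[OF S] p.H.ext0_conj_class[OF p.subgroup_img_is_subgroup[OF S]])
qed

lemma Inf_V_hom: "Inf_V G H \<in> hom (V (G Mod H)) (V G)"
proof (rule homI)
  show "Inf_V G H x \<in> carrier (V G)" for x
    by (simp add: V_simps Inf_V_def)
  fix x y
  show "Inf_V G H (x \<otimes>\<^bsub>V (G Mod H)\<^esub> y) = Inf_V G H x \<otimes>\<^bsub>V G\<^esub> Inf_V G H y"
  proof
    fix c
    show "Inf_V G H (x \<otimes>\<^bsub>V (G Mod H)\<^esub> y) c = (Inf_V G H x \<otimes>\<^bsub>V G\<^esub> Inf_V G H y) c"
    proof (cases "c \<in> Sub_ncc_classes G")
      case True
      then obtain S where S: "subgroup S G" "\<not> core_cyclic G S" "c = conj_class G S"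
        by (auto simp: Sub_ncc_classes_def Sub_ncc_def)
      then show ?thesis
        using True by (simp add: V_simps(2)[of G] Inf_V_conj_class ext0_mult)
    qed (simp add: V_simps(2)[of G] Inf_V_def)
  qed
qed

text \<open>A conjugate of the image of S is the image of a conjugate of S. That conjugate still
  contains \<open>H\<close>, so lifting recovers it, and all lifts lie in the class of S.\<close>

lemma Fix_V_conj_class:
  assumes S: "subgroup S G" and HS: "H \<subseteq> S" and ncc: "\<not> core_cyclic G S"
  shows "Fix_V G H y (conj_class (G Mod H) (proj G H ` S)) = y (conj_class G S)"
proof -
  interpret p: group_hom G "G Mod H" "proj G H" by (rule proj_hom)
  have sub: "S \<subseteq> carrier G" using S by (rule subgroup.subset)
  have pS: "subgroup (proj G H ` S) (G Mod H)" using S by (rule p.subgroup_img_is_subgroup)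
  have "\<not> core_cyclic (G Mod H) (proj G H ` S)"
    using ncc p.core_cyclic_image_iff[OF proj_surj S] HS by (simp add: kernel_proj)
  then have mem: "conj_class (G Mod H) (proj G H ` S) \<in> Sub_ncc_classes (G Mod H)"
    by (simp add: p.H.conj_class_mem_Sub_ncc_classes_iff[OF pS])
  have "y (conj_class G (lift G H L)) = y (conj_class G S)"
    if L: "L \<in> conj_class (G Mod H) (proj G H ` S)" for L
  proof -
    obtain q where q: "q \<in> carrier G" "L = proj G H ` conj_by G q S"
      using L unfolding p.conj_class_image[OF proj_surj sub] by (auto simp: conj_class_def)
    then have "lift G H L = conj_by G q S"
      using lift_proj[OF subgroup_conj_by[OF q(1) S] subset_conj_by[OF q(1) HS]] by simp
    then show ?thesis using q sub by (simp add: conj_class_conj_by)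
  qed
  then show ?thesis
    unfolding Fix_V_def restrict_apply'[OF mem]
    using p.H.mem_conj_class[OF subgroup.subset[OF pS]] by (intro the_elem_image_unique) auto
qed

text \<open>Above \<open>H\<close>, S and its image are core-cyclic together, so both zero
  extensions take their default value at the same time.\<close>

lemma ext0_Fix_V:
  assumes S: "subgroup S G" and HS: "H \<subseteq> S"
  shows "ext0 (G Mod H) (Fix_V G H y) (conj_class (G Mod H) (proj G H ` S))
    = ext0 G y (conj_class G S)"
proof -
  interpret p: group_hom G "G Mod H" "proj G H" by (rule proj_hom)
  have "core_cyclic (G Mod H) (proj G H ` S) \<longleftrightarrow> core_cyclic G S"
    using p.core_cyclic_image_iff[OF proj_surj S] HS by (simp add: kernel_proj)
  then show ?thesis
    using Fix_V_conj_class[OF S HS, of y]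
    by (simp add: ext0_conj_class[OF S] p.H.ext0_conj_class[OF p.subgroup_img_is_subgroup[OF S]])
qed

lemma Fix_V_hom: "Fix_V G H \<in> hom (V G) (V (G Mod H))"
proof (rule homI)
  interpret p: group_hom G "G Mod H" "proj G H" by (rule proj_hom)
  show "Fix_V G H x \<in> carrier (V (G Mod H))" for x
    by (simp add: V_simps Fix_V_def)
  fix x y
  show "Fix_V G H (x \<otimes>\<^bsub>V G\<^esub> y) = Fix_V G H x \<otimes>\<^bsub>V (G Mod H)\<^esub> Fix_V G H y"
  proof
    fix c
    show "Fix_V G H (x \<otimes>\<^bsub>V G\<^esub> y) c = (Fix_V G H x \<otimes>\<^bsub>V (G Mod H)\<^esub> Fix_V G H y) c"
    proof (cases "c \<in> Sub_ncc_classes (G Mod H)")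
      case True
      then obtain L where L: "subgroup L (G Mod H)" "c = conj_class (G Mod H) L"
        by (auto simp: Sub_ncc_classes_def Sub_ncc_def)
      \<comment> \<open>This rewrites a coordinate of \<open>Fix_V\<close> as an evaluation of
        \<open>ext0\<close>, whose additivity is \<open>ext0_mult\<close>.\<close>
      have "Fix_V G H z c = ext0 G z (conj_class G (lift G H L))" for z
        using ext0_Fix_V[OF subgroup_lift[OF L(1)] subset_lift[OF L(1)], of z] True L
        by (simp add: proj_lift ext0_def)
      then show ?thesis
        using True by (simp add: V_simps(2)[of "G Mod H"] ext0_mult)
    qed (simp add: V_simps(2)[of "G Mod H"] Fix_V_def)
  qed
qed

text \<open>\<open>lam_image\<close> along the projection writes \<open>lam\<close> of the inflated
  vector as a pullback from the image of S. That image may lie outside \<open>R'\<close>, and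
  \<open>component_Def\<close> supplies the value there.\<close>

lemma Def_Inf_V:
  assumes R': "class_reps (G Mod H) R'" and R: "class_reps G R"
  shows "Def G R (Inf_V G H x) = Inf_D G H R R' (Def (G Mod H) R' x)"
proof -
  interpret p: group_hom G "G Mod H" "proj G H" by (rule proj_hom)
  have "dclass (Weyl G S) (lam G (Inf_V G H x) S)
      = pullback (Weyl G S) (image (proj G H))
          (component (G Mod H) R' (Def (G Mod H) R' x) (proj G H ` S))" if "S \<in> R" for S
  proof -
    have S: "subgroup S G" using R that by (auto simp: class_reps_def)
    have pS: "subgroup (proj G H ` S) (G Mod H)" using S by (rule p.subgroup_img_is_subgroup)
    interpret W: group_hom "Weyl G S" "Weyl (G Mod H) (proj G H ` S)" "image (proj G H)"
      using S by (rule p.Weyl_hom)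
    show ?thesis
      by (simp add: p.H.component_Def[OF R' pS] W.pullback_dclass p.H.lam_Cl0[OF pS]
          p.lam_image[OF S ext0_Inf_V])
  qed
  then show ?thesis unfolding Def_def[of G] Inf_D_def by (intro restrict_ext)
qed

text \<open>At the lift of L the class of \<open>lam\<close> is the pullback of the class at L; the
  Weyl groups map onto each other, so the pullback is injective and \<open>inv_into\<close> cancels
  it.\<close>

lemma Def_Fix_V:
  assumes R': "class_reps (G Mod H) R'" and R: "\<forall>L\<in>R'. lift G H L \<in> R"
  shows "Def (G Mod H) R' (Fix_V G H y) = Fix_D G H R' (Def G R y)"
proof -
  interpret p: group_hom G "G Mod H" "proj G H" by (rule proj_hom)
  have "inv_into (carrier (defect (Weyl (G Mod H) L)))
      (pullback (Weyl G (lift G H L)) (image (proj G H)))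
      (dclass (Weyl G (lift G H L)) (lam G y (lift G H L)))
    = dclass (Weyl (G Mod H) L) (lam (G Mod H) (Fix_V G H y) L)" if "L \<in> R'" for L
  proof -
    have L: "subgroup L (G Mod H)" using R' that by (auto simp: class_reps_def)
    note S = subgroup_lift[OF L] and HS = subset_lift[OF L]
    interpret W: group_hom "Weyl G (lift G H L)" "Weyl (G Mod H) L" "image (proj G H)"
      using p.Weyl_hom[OF S] by (simp add: proj_lift[OF L])
    have inj: "inj_on (pullback (Weyl G (lift G H L)) (image (proj G H)))
        (carrier (defect (Weyl (G Mod H) L)))"
      using W.inj_on_pullback p.Weyl_surj[OF proj_surj S] HS
      by (simp add: proj_lift[OF L] kernel_proj)
    \<comment> \<open>Each subgroup above the lift contains \<open>H\<close>, so
      \<open>ext0_Fix_V\<close> supplies the agreement for \<open>lam_image\<close>.\<close>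
    have "lam G y (lift G H L)
        = compose (carrier (Weyl G (lift G H L))) (lam (G Mod H) (Fix_V G H y) L) (image (proj G H))"
      using p.lam_image[OF S, of y "Fix_V G H y"] HS ext0_Fix_V
      by (simp add: proj_lift[OF L] subset_trans)
    then have "dclass (Weyl G (lift G H L)) (lam G y (lift G H L))
        = pullback (Weyl G (lift G H L)) (image (proj G H))
            (dclass (Weyl (G Mod H) L) (lam (G Mod H) (Fix_V G H y) L))"
      by (simp add: W.pullback_dclass p.H.lam_Cl0[OF L])
    then show ?thesis
      using inv_into_f_f[OF inj] p.H.lam_Cl0[OF L] by (simp add: W.H.carrier_defect)
  qed
  \<comment> \<open>Since the lift of L belongs to \<open>R\<close>, the value of
    \<open>Def G R y\<close> there is the class of \<open>lam\<close> and not the default of a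
    restricted function.\<close>
  then show ?thesis
    using R unfolding Fix_D_def Def_def[of "G Mod H"] by (intro restrict_ext) (simp add: Def_def)
qed

end

theorem theorem6p12:
  fixes G :: "('a, 'b) monoid_scheme" and N :: "'a set"
    and R :: "'a set set" and R' :: "'a set set set"
  assumes "group G" and "finite (carrier G)" and "N \<lhd> G"
    and "class_reps G R" and "class_reps (G Mod N) R'"
    and "\<forall>L\<in>R'. lift G N L \<in> R"
  shows "compose (carrier (V (G Mod N))) (Def G R) (Inf_V G N)
           = compose (carrier (V (G Mod N))) (Inf_D G N R R') (Def (G Mod N) R')
       \<and> compose (carrier (V (G Mod N))) (Def G R) (Inf_V G N) \<in> hom (V (G Mod N)) (DD G R)
       \<and> compose (carrier (V G)) (Def (G Mod N) R') (Fix_V G N)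
           = compose (carrier (V G)) (Fix_D G N R') (Def G R)
       \<and> compose (carrier (V G)) (Def (G Mod N) R') (Fix_V G N) \<in> hom (V G) (DD (G Mod N) R')"
proof -
  interpret normal N G by fact
  interpret Q: group "G Mod N" by (rule factorgroup_is_group)
  have fin: "finite (carrier (G Mod N))"
    using assms(2) by (simp add: carrier_FactGroup)
  show ?thesis
    \<comment> \<open>The relations hold pointwise, and \<open>compose\<close> restricts them to the
      carriers; linearity follows by composing homomorphisms.\<close>
    using group.hom_compose[OF group_V Inf_V_hom Def_hom[OF assms(2,4)]]
      group.hom_compose[OF group_V Fix_V_hom Q.Def_hom[OF fin assms(5)]]
      Def_Inf_V[OF assms(5,4)] Def_Fix_V[OF assms(5,6)]
    by (simp add: compose_def)
qed

end
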